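(* Let $G$ be a locally compact group. Then $\mathscr{CB}(G)/\mathscr{LUC}(G)$ contains a linear isometric copy of $\ell_\infty(\kappa(G))$ if and only if $G$ is neither compact nor discrete.
   Context: All groups are Hausdorff, with identity $e$. The compact covering number $\kappa(G)$ is the smallest cardinal number of compact subsets of $G$ required to cover $G$. $\mathscr{CB}(G)$ is the algebra of bounded continuous complex-valued functions on $G$ with the supremum norm. $\mathscr{LUC}(G)$ is the algebra of bounded functions $f$ on $G$ such that for every $\epsilon>0$ there is a neighbourhood $U$ of $e$ with $|f(s)-f(t)|<\epsilon$ whenever $st^{-1}\in U$. $\ell_\infty(\kappa)$ is the space of bounded complex functions on $\kappa$ with the supremum norm. A Banach space contains a linear isometric copy of $\ell_\infty(\kappa)$ if there is a linear (not necessarily surjective) isometry of $\ell_\infty(\kappa)$ into it. Quotients carry the quotient norm. *)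

theory Defs
  imports "HOL-Analysis.Analysis"
begin

text \<open>
  Topological groups are types of class \<open>topological_group_add\<close>. This class is
  written additively but is not assumed commutative: the identity \<open>e\<close> is \<open>0\<close>, and
  \<open>s t\<^sup>-\<^sup>1\<close> is \<open>s - t\<close>, that is \<open>s + (- t)\<close>. The algebra of bounded continuous
  complex-valued functions with the supremum norm is the type \<open>'g \<Rightarrow>\<^sub>C complex\<close>.
\<close>

section \<open>The compact covering number\<close>

unbundle cardinal_syntax

definition compact_cover :: "'a::topological_space set \<Rightarrow> 'a set set \<Rightarrow> bool"
  where "compact_cover S C \<longleftrightarrow> (\<forall>K\<in>C. compact K) \<and> \<Union>C = S"

text \<open>
  A cardinal is represented, as in the library, by a cardinal order. The one chosen
  here is the cardinal order of some compact cover of least cardinality;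
  it is determined up to order isomorphism (\<open>=o\<close>).
\<close>

definition compact_covering_number :: "'a::topological_space set \<Rightarrow> 'a set rel"
  where "compact_covering_number S =
    (SOME r. (\<exists>C. compact_cover S C \<and> r = card_of C) \<and>
             (\<forall>C. compact_cover S C \<longrightarrow> r \<le>o card_of C))"

lemma compact_covering_number:
  fixes S :: "'a::topological_space set"
  shows "\<exists>C. compact_cover S C \<and> compact_covering_number S = card_of C"
    and "compact_cover S C \<Longrightarrow> compact_covering_number S \<le>o card_of C"
proof -
  let ?R = "card_of ` {C. compact_cover S C}"
  have "compact_cover S ((\<lambda>x. {x}) ` S)"
    by (auto simp: compact_cover_def)
  then have ne: "?R \<noteq> {}"
    by blast
  have "\<forall>r\<in>?R. Card_order r"
    by (auto simp: card_of_Card_order)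
  from exists_minim_Card_order[OF ne this]
  have "\<exists>r. (\<exists>C. compact_cover S C \<and> r = card_of C) \<and>
            (\<forall>C. compact_cover S C \<longrightarrow> r \<le>o card_of C)"
    by auto
  from someI_ex[OF this, folded compact_covering_number_def]
  show "\<exists>C. compact_cover S C \<and> compact_covering_number S = card_of C"
    and "compact_cover S C \<Longrightarrow> compact_covering_number S \<le>o card_of C"
    by blast+
qed


section \<open>The spaces \<open>\<ell>\<^sub>\<infinity>(I)\<close>\<close>

text \<open>
  Functions on \<open>I\<close> are represented by functions on the whole type that vanish off \<open>I\<close>,
  so the supremum over the type is the supremum over \<open>I\<close> (and is \<open>0\<close> if \<open>I\<close> is empty).
\<close>

definition linfty :: "'i set \<Rightarrow> ('i \<Rightarrow> complex) set"
  where "linfty I = {x. bounded (range x) \<and> (\<forall>i. i \<notin> I \<longrightarrow> x i = 0)}"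

definition linfty_norm :: "('i \<Rightarrow> complex) \<Rightarrow> real"
  where "linfty_norm x = (SUP i. cmod (x i))"

text \<open>
  The library has no class of complex normed spaces; the complex scalar multiplication
  \<open>smul\<close> of the target is therefore passed explicitly.
\<close>

definition contains_linfty_copy :: "(complex \<Rightarrow> 'v::real_normed_vector \<Rightarrow> 'v) \<Rightarrow> 'i set \<Rightarrow> bool"
  where "contains_linfty_copy smul I \<longleftrightarrow>
    (\<exists>T :: ('i \<Rightarrow> complex) \<Rightarrow> 'v.
        (\<forall>x\<in>linfty I. \<forall>y\<in>linfty I. T (\<lambda>i. x i + y i) = T x + T y) \<and>
        (\<forall>c. \<forall>x\<in>linfty I. T (\<lambda>i. c * x i) = smul c (T x)) \<and>
        (\<forall>x\<in>linfty I. norm (T x) = linfty_norm x))"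


section \<open>The algebra \<open>LUC(G)\<close>\<close>

definition LUC :: "('g::topological_group_add \<Rightarrow> complex) set"
  where "LUC = {f. bounded (range f) \<and>
    (\<forall>\<epsilon>>0. \<exists>U. open U \<and> 0 \<in> U \<and> (\<forall>s t. s - t \<in> U \<longrightarrow> cmod (f s - f t) < \<epsilon>))}"

lemma LUC_subset_bcontfun: "LUC \<subseteq> bcontfun"
proof
  fix f :: "'a \<Rightarrow> complex"
  assume f: "f \<in> LUC"
  have "(f \<longlongrightarrow> f x) (at x)" for x
    unfolding tendsto_iff dist_norm
  proof (intro allI impI)
    fix e :: real
    assume "e > 0"
    with f obtain U where U: "open U" "0 \<in> U" "\<And>s t. s - t \<in> U \<Longrightarrow> cmod (f s - f t) < e"
      unfolding LUC_def by blast
    have "((\<lambda>s. s - x) \<longlongrightarrow> x - x) (at x)"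
      by (intro tendsto_intros)
    then have "\<forall>\<^sub>F s in at x. s - x \<in> U"
      using U(1,2) by (intro topological_tendstoD) auto
    then show "\<forall>\<^sub>F s in at x. cmod (f s - f x) < e"
      by eventually_elim (rule U(3))
  qed
  then have "continuous_on UNIV f"
    unfolding continuous_on_def by simp
  with f show "f \<in> bcontfun"
    by (simp add: bcontfun_def LUC_def)
qed

lemma bounded_range_mult:
  fixes f :: "'a \<Rightarrow> complex"
  assumes "bounded (range f)"
  shows "bounded (range (\<lambda>x. c * f x))"
  using bounded_linear_image[OF assms bounded_linear_mult_right[of c]] by (simp add: image_image)

definition LUC_bcontfun :: "('g::topological_group_add \<Rightarrow>\<^sub>C complex) set"
  where "LUC_bcontfun = {f. apply_bcontfun f \<in> LUC}"

context
  includes bcontfun.lifting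
begin

lift_definition scaleC_bcontfun ::
  "complex \<Rightarrow> ('a::topological_space \<Rightarrow>\<^sub>C complex) \<Rightarrow> 'a \<Rightarrow>\<^sub>C complex"
  is "\<lambda>c f x. c * f x"
proof -
  fix c :: complex and f :: "'a \<Rightarrow> complex"
  assume "f \<in> bcontfun"
  then show "(\<lambda>x. c * f x) \<in> bcontfun"
    by (simp add: bcontfun_def continuous_on_mult_left bounded_range_mult)
qed

end

lemma LUC_scale:
  assumes "f \<in> LUC"
  shows "(\<lambda>x. c * f x) \<in> LUC"
proof (cases "c = 0")
  case True
  then show ?thesis
    by (auto simp: LUC_def intro!: exI[of _ UNIV])
next
  case False
  have "bounded (range (\<lambda>x. c * f x))"
    using assms by (auto simp: LUC_def intro!: bounded_range_mult)
  moreover have "\<exists>U. open U \<and> 0 \<in> U \<and> (\<forall>s t. s - t \<in> U \<longrightarrow> cmod (c * f s - c * f t) < e)"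
    if "e > 0" for e
  proof -
    have "e / cmod c > 0"
      using that False by simp
    with assms obtain U where U: "open U" "0 \<in> U"
      "\<And>s t. s - t \<in> U \<Longrightarrow> cmod (f s - f t) < e / cmod c"
      unfolding LUC_def by blast
    have "cmod (c * f s - c * f t) < e" if "s - t \<in> U" for s t
    proof -
      have "cmod (c * f s - c * f t) = cmod c * cmod (f s - f t)"
        by (simp only: right_diff_distrib[symmetric] norm_mult)
      with U(3)[OF that] False show ?thesis
        by (simp add: field_simps)
    qed
    with U show ?thesis
      by blast
  qed
  ultimately show ?thesis
    by (auto simp: LUC_def)
qed

lemma LUC_add:
  assumes "f \<in> LUC" "g \<in> LUC"
  shows "(\<lambda>x. f x + g x) \<in> LUC"
proof -
  have "bounded (range (\<lambda>x. f x + g x))"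
    using assms by (auto simp: LUC_def intro!: bounded_plus_comp)
  moreover have "\<exists>U. open U \<and> 0 \<in> U \<and>
      (\<forall>s t. s - t \<in> U \<longrightarrow> cmod ((f s + g s) - (f t + g t)) < e)"
    if "e > 0" for e
  proof -
    have e: "e / 2 > 0"
      using that by simp
    obtain U where U: "open U" "0 \<in> U" "\<And>s t. s - t \<in> U \<Longrightarrow> cmod (f s - f t) < e / 2"
      using assms(1) e unfolding LUC_def by blast
    obtain V where V: "open V" "0 \<in> V" "\<And>s t. s - t \<in> V \<Longrightarrow> cmod (g s - g t) < e / 2"
      using assms(2) e unfolding LUC_def by blast
    have "cmod ((f s + g s) - (f t + g t)) < e" if "s - t \<in> U \<inter> V" for s t
      using norm_diff_triangle_ineq[of "f s" "g s" "f t" "g t"] U(3)[of s t] V(3)[of s t] that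
      by simp
    with U V show ?thesis
      by (intro exI[of _ "U \<inter> V"]) auto
  qed
  ultimately show ?thesis
    by (auto simp: LUC_def)
qed

lemma LUC_bcontfun_scaleC: "f \<in> LUC_bcontfun \<Longrightarrow> scaleC_bcontfun c f \<in> LUC_bcontfun"
  by (simp add: LUC_bcontfun_def scaleC_bcontfun.rep_eq LUC_scale)

lemma LUC_bcontfun_add: "f \<in> LUC_bcontfun \<Longrightarrow> g \<in> LUC_bcontfun \<Longrightarrow> f + g \<in> LUC_bcontfun"
  using LUC_add[of "apply_bcontfun f" "apply_bcontfun g"] by (simp add: LUC_bcontfun_def)

lemma LUC_bcontfun_scaleR: "f \<in> LUC_bcontfun \<Longrightarrow> r *\<^sub>R f \<in> LUC_bcontfun"
  using LUC_scale[of "apply_bcontfun f" "of_real r"]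
  by (simp add: LUC_bcontfun_def scaleR_conv_of_real)

lemma LUC_bcontfun_zero: "0 \<in> LUC_bcontfun"
proof -
  have "bounded (range (\<lambda>x::'a. 0::complex))"
    by (simp add: image_constant_conv)
  then have "(\<lambda>x::'a. 0) \<in> LUC"
    unfolding LUC_def by (force intro: open_UNIV)
  then show ?thesis
    by (simp add: LUC_bcontfun_def zero_bcontfun.rep_eq[abs_def])
qed

lemma LUC_bcontfun_uminus: "f \<in> LUC_bcontfun \<Longrightarrow> - f \<in> LUC_bcontfun"
  using LUC_bcontfun_scaleR[of f "-1"] by simp

lemma LUC_bcontfun_diff: "f \<in> LUC_bcontfun \<Longrightarrow> g \<in> LUC_bcontfun \<Longrightarrow> f - g \<in> LUC_bcontfun"
  using LUC_bcontfun_add[of f "- g"] LUC_bcontfun_uminus[of g] by simp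

lemma closed_LUC_bcontfun: "closed LUC_bcontfun"
  unfolding closure_subset_eq[symmetric]
proof
  fix f :: "'g::topological_group_add \<Rightarrow>\<^sub>C complex"
  assume "f \<in> closure LUC_bcontfun"
  then have *: "\<forall>e>0. \<exists>h\<in>LUC_bcontfun. dist h f < e"
    by (simp add: closure_approachable)
  have "\<exists>U. open U \<and> 0 \<in> U \<and> (\<forall>s t. s - t \<in> U \<longrightarrow> cmod (f s - f t) < e)" if "e > 0" for e
  proof -
    have e: "e / 3 > 0"
      using that by simp
    with * obtain h where h: "h \<in> LUC_bcontfun" "dist h f < e / 3"
      by blast
    from h(1) e obtain U where U: "open U" "0 \<in> U" "\<And>s t. s - t \<in> U \<Longrightarrow> cmod (h s - h t) < e / 3"
      unfolding LUC_bcontfun_def LUC_def by blast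
    have "dist (f s) (f t) < e" if "s - t \<in> U" for s t
      using U(3)[OF that, folded dist_norm] dist_fun_lt_imp_dist_val_lt[OF h(2), of s]
        dist_fun_lt_imp_dist_val_lt[OF h(2), of t] dist_triangle[of "f s" "f t" "h s"]
        dist_triangle[of "h s" "f t" "h t"] dist_commute[of "f s" "h s"]
      by linarith
    with U show ?thesis
      by (auto simp: dist_norm)
  qed
  then show "f \<in> LUC_bcontfun"
    by (simp add: LUC_bcontfun_def LUC_def)
qed


section \<open>The quotient \<open>CB(G)/LUC(G)\<close>\<close>

definition luc_rel :: "('g::topological_group_add \<Rightarrow>\<^sub>C complex) \<Rightarrow> ('g \<Rightarrow>\<^sub>C complex) \<Rightarrow> bool"
  where "luc_rel f g \<longleftrightarrow> f - g \<in> LUC_bcontfun"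

lemma equivp_luc_rel:
  "equivp (luc_rel :: ('g::topological_group_add \<Rightarrow>\<^sub>C complex) \<Rightarrow> _)"
proof (rule equivpI)
  show "reflp (luc_rel :: ('g \<Rightarrow>\<^sub>C complex) \<Rightarrow> _)"
    by (simp add: reflp_def luc_rel_def LUC_bcontfun_zero)
  show "symp (luc_rel :: ('g \<Rightarrow>\<^sub>C complex) \<Rightarrow> _)"
  proof (rule sympI)
    fix f g :: "'g \<Rightarrow>\<^sub>C complex"
    assume "luc_rel f g"
    then show "luc_rel g f"
      using LUC_bcontfun_uminus[of "f - g"] by (simp add: luc_rel_def)
  qed
  show "transp (luc_rel :: ('g \<Rightarrow>\<^sub>C complex) \<Rightarrow> _)"
  proof (rule transpI)
    fix f g h :: "'g \<Rightarrow>\<^sub>C complex"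
    assume "luc_rel f g" "luc_rel g h"
    then show "luc_rel f h"
      using LUC_bcontfun_add[of "f - g" "g - h"] by (simp add: luc_rel_def)
  qed
qed

quotient_type (overloaded) 'g cb_mod_luc = "'g::topological_group_add \<Rightarrow>\<^sub>C complex" / luc_rel
  by (rule equivp_luc_rel)

lemma luc_quotient_norm_cong:
  assumes "luc_rel f g"
  shows "(INF h\<in>LUC_bcontfun. norm (f - h)) = (INF h\<in>LUC_bcontfun. norm (g - h))"
proof -
  have "(\<lambda>h. norm (f - h)) ` LUC_bcontfun \<subseteq> (\<lambda>h. norm (g - h)) ` LUC_bcontfun"
    if "luc_rel f g" for f g :: "'a \<Rightarrow>\<^sub>C complex"
  proof
    fix r
    assume "r \<in> (\<lambda>h. norm (f - h)) ` LUC_bcontfun"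
    then obtain h where h: "h \<in> LUC_bcontfun" "r = norm (f - h)"
      by blast
    have "h - (f - g) \<in> LUC_bcontfun"
      using LUC_bcontfun_diff[OF h(1)] that by (simp add: luc_rel_def)
    moreover have "r = norm (g - (h - (f - g)))"
      by (simp add: h(2))
    ultimately show "r \<in> (\<lambda>h. norm (g - h)) ` LUC_bcontfun"
      by blast
  qed
  from this[OF assms] this[OF equivp_symp[OF equivp_luc_rel assms]] show ?thesis
    by (metis subset_antisym)
qed

instantiation cb_mod_luc :: (topological_group_add) real_vector
begin

lift_definition zero_cb_mod_luc :: "'a cb_mod_luc" is 0 .

lift_definition plus_cb_mod_luc :: "'a cb_mod_luc \<Rightarrow> 'a cb_mod_luc \<Rightarrow> 'a cb_mod_luc" is "(+)"
  unfolding luc_rel_def add_diff_add by (rule LUC_bcontfun_add)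

lift_definition uminus_cb_mod_luc :: "'a cb_mod_luc \<Rightarrow> 'a cb_mod_luc" is uminus
  unfolding luc_rel_def minus_diff_minus by (rule LUC_bcontfun_uminus)

lift_definition minus_cb_mod_luc :: "'a cb_mod_luc \<Rightarrow> 'a cb_mod_luc \<Rightarrow> 'a cb_mod_luc" is "(-)"
  unfolding luc_rel_def by (drule (1) LUC_bcontfun_diff) (simp add: algebra_simps)

lift_definition scaleR_cb_mod_luc :: "real \<Rightarrow> 'a cb_mod_luc \<Rightarrow> 'a cb_mod_luc" is scaleR
  unfolding luc_rel_def scaleR_diff_right[symmetric] by (rule LUC_bcontfun_scaleR)

instance
  by standard (transfer; simp add: luc_rel_def LUC_bcontfun_zero algebra_simps)+

end

lift_definition scaleC_cb_mod_luc ::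
  "complex \<Rightarrow> 'g::topological_group_add cb_mod_luc \<Rightarrow> 'g cb_mod_luc" is scaleC_bcontfun
proof -
  fix c and f g :: "'g \<Rightarrow>\<^sub>C complex"
  assume "luc_rel f g"
  moreover have "scaleC_bcontfun c f - scaleC_bcontfun c g = scaleC_bcontfun c (f - g)"
    by (rule bcontfun_eqI) (simp add: scaleC_bcontfun.rep_eq right_diff_distrib)
  ultimately show "luc_rel (scaleC_bcontfun c f) (scaleC_bcontfun c g)"
    by (simp add: luc_rel_def LUC_bcontfun_scaleC)
qed

instantiation cb_mod_luc :: (topological_group_add) real_normed_vector
begin

lift_definition norm_cb_mod_luc :: "'a cb_mod_luc \<Rightarrow> real"
  is "\<lambda>f. INF h\<in>LUC_bcontfun. norm (f - h)"
  by (rule luc_quotient_norm_cong)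

definition dist_cb_mod_luc :: "'a cb_mod_luc \<Rightarrow> 'a cb_mod_luc \<Rightarrow> real"
  where "dist_cb_mod_luc x y = norm (x - y)"

definition sgn_cb_mod_luc :: "'a cb_mod_luc \<Rightarrow> 'a cb_mod_luc"
  where "sgn_cb_mod_luc x = x /\<^sub>R norm x"

definition uniformity_cb_mod_luc :: "('a cb_mod_luc \<times> 'a cb_mod_luc) filter"
  where "uniformity_cb_mod_luc = (INF e\<in>{0 <..}. principal {(x, y). dist x y < e})"

definition open_cb_mod_luc :: "'a cb_mod_luc set \<Rightarrow> bool"
  where "open_cb_mod_luc S = (\<forall>x\<in>S. \<forall>\<^sub>F (x', y) in uniformity. x' = x \<longrightarrow> y \<in> S)"

instance
proof
  have inf: "(INF h\<in>LUC_bcontfun. norm (f - h)) = infdist f LUC_bcontfun"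
    for f :: "'a \<Rightarrow>\<^sub>C complex"
    using LUC_bcontfun_zero by (auto simp: infdist_def dist_norm)
  fix x y :: "'a cb_mod_luc" and a :: real
  show "norm x = 0 \<longleftrightarrow> x = 0"
  proof transfer
    fix f :: "'a \<Rightarrow>\<^sub>C complex"
    show "(INF h\<in>LUC_bcontfun. norm (f - h)) = 0 \<longleftrightarrow> luc_rel f 0"
      unfolding inf luc_rel_def
      using in_closed_iff_infdist_zero[OF closed_LUC_bcontfun, of f] LUC_bcontfun_zero by auto
  qed
  show "norm (x + y) \<le> norm x + norm y"
  proof transfer
    fix f g :: "'a \<Rightarrow>\<^sub>C complex"
    have "infdist (f + g) LUC_bcontfun \<le> infdist f LUC_bcontfun + infdist g LUC_bcontfun"
    proof (rule field_le_epsilon)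
      fix e :: real
      assume "e > 0"
      have *: "\<exists>h\<in>LUC_bcontfun. dist f h < infdist f LUC_bcontfun + e / 2"
        for f :: "'a \<Rightarrow>\<^sub>C complex"
        using \<open>e > 0\<close> LUC_bcontfun_zero cInf_lessD[of "dist f ` LUC_bcontfun" "infdist f LUC_bcontfun + e / 2"]
        by (auto simp: infdist_def split: if_splits)
      obtain h k where hk: "h \<in> LUC_bcontfun" "dist f h < infdist f LUC_bcontfun + e / 2"
        "k \<in> LUC_bcontfun" "dist g k < infdist g LUC_bcontfun + e / 2"
        using *[of f] *[of g] by blast
      have "infdist (f + g) LUC_bcontfun \<le> dist (f + g) (h + k)"
        by (intro infdist_le LUC_bcontfun_add hk)
      also have "\<dots> \<le> dist f h + dist g k"
        by (rule dist_triangle_add)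
      finally show "infdist (f + g) LUC_bcontfun
          \<le> infdist f LUC_bcontfun + infdist g LUC_bcontfun + e"
        using hk by simp
    qed
    then show "(INF h\<in>LUC_bcontfun. norm (f + g - h))
        \<le> (INF h\<in>LUC_bcontfun. norm (f - h)) + (INF h\<in>LUC_bcontfun. norm (g - h))"
      by (simp only: inf)
  qed
  show "norm (a *\<^sub>R x) = \<bar>a\<bar> * norm x"
  proof transfer
    fix a :: real and f :: "'a \<Rightarrow>\<^sub>C complex"
    have le: "infdist (a *\<^sub>R f) LUC_bcontfun \<le> \<bar>a\<bar> * infdist f LUC_bcontfun"
      if "a \<noteq> 0" for a :: real and f :: "'a \<Rightarrow>\<^sub>C complex"
    proof -
      have "infdist (a *\<^sub>R f) LUC_bcontfun / \<bar>a\<bar> \<le> infdist f LUC_bcontfun"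
        unfolding inf[of f, symmetric]
      proof (rule cINF_greatest)
        fix h :: "'a \<Rightarrow>\<^sub>C complex"
        assume "h \<in> LUC_bcontfun"
        then have "infdist (a *\<^sub>R f) LUC_bcontfun \<le> dist (a *\<^sub>R f) (a *\<^sub>R h)"
          by (intro infdist_le LUC_bcontfun_scaleR)
        then show "infdist (a *\<^sub>R f) LUC_bcontfun / \<bar>a\<bar> \<le> norm (f - h)"
          using that
          by (simp only: dist_norm scaleR_diff_right[symmetric] norm_scaleR)
             (simp add: divide_le_eq mult.commute)
      qed (use LUC_bcontfun_zero in auto)
      then show ?thesis
        using that by (simp add: field_simps)
    qed
    have "infdist (a *\<^sub>R f) LUC_bcontfun = \<bar>a\<bar> * infdist f LUC_bcontfun"
    proof (cases "a = 0")
      case True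
      then show ?thesis
        using infdist_zero[OF LUC_bcontfun_zero] by simp
    next
      case False
      have "infdist f LUC_bcontfun \<le> \<bar>inverse a\<bar> * infdist (a *\<^sub>R f) LUC_bcontfun"
        using le[of "inverse a" "a *\<^sub>R f"] False by simp
      then have "\<bar>a\<bar> * infdist f LUC_bcontfun \<le> infdist (a *\<^sub>R f) LUC_bcontfun"
        using False by (simp add: field_simps)
      with le[OF False, of f] show ?thesis
        by simp
    qed
    then show "(INF h\<in>LUC_bcontfun. norm (a *\<^sub>R f - h))
        = \<bar>a\<bar> * (INF h\<in>LUC_bcontfun. norm (f - h))"
      by (simp only: inf)
  qed
qed (simp_all add: dist_cb_mod_luc_def sgn_cb_mod_luc_def uniformity_cb_mod_luc_def
      open_cb_mod_luc_def)

end

end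

theory Submission
  imports Defs
begin

text \<open>
  If \<open>G\<close> is compact or discrete, every bounded continuous function is uniformly continuous, so
  the quotient is \<open>0\<close>, while \<open>\<kappa>(G) \<ge> 1\<close> makes \<open>\<ell>\<^sub>\<infinity>(\<kappa>(G))\<close> nonzero.

  For the converse, let \<open>G\<close> be neither compact nor discrete, and let \<open>U\<close> be a relatively compact
  open neighbourhood of the identity. A function that takes the values \<open>c\<close> and \<open>- c\<close> at pairs of
  points \<open>s, t\<close> with \<open>s - t\<close> in any prescribed neighbourhood of \<open>0\<close> has distance at least
  \<open>\<bar>c\<bar>\<close> from \<open>LUC(G)\<close> (\<open>norm_le_if_opposite_values_close\<close>). No single continuous function
  on the compact closure of \<open>U\<close> behaves like this, but a sequence \<open>\<psi>\<^sub>n\<close> of functions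
  supported in \<open>U\<close> can (\<open>oscillating_sequence\<close>): fix distinct points
  \<open>x\<^sub>0, x\<^sub>1, \<dots>\<close> of \<open>U\<close> and let \<open>\<psi>\<^sub>n\<close> be \<open>1\<close> at \<open>x\<^sub>n\<close> and \<open>-1\<close> at all
  earlier points. By compactness the points accumulate, so that differences
  \<open>x\<^sub>n - x\<^sub>m\<close> with \<open>m < n\<close> lie in every neighbourhood of \<open>0\<close>. This replaces a
  sequence of neighbourhoods shrinking to \<open>0\<close>, which exists only in metrizable groups.

  Since differences \<open>s - t\<close> are invariant under right translation, the \<open>\<psi>\<^sub>n\<close> may be moved to
  separate places of the group without losing their oscillation. A maximal set \<open>T\<close> of
  points whose differences avoid a suitable compact set \<open>L\<close> provides these places: by maximality the
  translates of \<open>L\<close> by \<open>T\<close> cover \<open>G\<close>, so \<open>T\<close> is infinite and has at least \<open>\<kappa>(G)\<close>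
  elements, hence room for \<open>\<kappa>(G) \<times> \<nat>\<close> of them (\<open>separated_family\<close>). Placing
  \<open>c\<^sub>i \<psi>\<^sub>n\<close> at the point with index \<open>(i, n)\<close> turns \<open>c \<in> \<ell>\<^sub>\<infinity>(\<kappa>(G))\<close> into a bounded
  function, continuous because the supports are locally finite. Its norm is at most
  \<open>sup \<bar>c\<^sub>i\<bar>\<close>, and its distance from \<open>LUC(G)\<close> is at least every \<open>\<bar>c\<^sub>i\<bar>\<close>, so the map
  is isometric into the quotient.
\<close>

section \<open>Compact and discrete groups\<close>

text \<open>
  The tube lemma makes the continuity of \<open>(v, t) \<mapsto> f (v + t)\<close> at the points \<open>(0, t)\<close> uniform
  in \<open>t\<close>.
\<close>

lemma bcontfun_subset_LUC_if_compact:
  assumes "compact (UNIV :: 'g::topological_group_add set)"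
  shows "(bcontfun :: ('g \<Rightarrow> complex) set) \<subseteq> LUC"
proof
  fix f :: "'g \<Rightarrow> complex"
  assume f: "f \<in> bcontfun"
  then have cont: "continuous_on UNIV f" and bdd: "bounded (range f)"
    by (auto simp: bcontfun_def)
  have "\<exists>U. open U \<and> 0 \<in> U \<and> (\<forall>s t. s - t \<in> U \<longrightarrow> cmod (f s - f t) < e)" if "e > 0" for e
  proof -
    let ?W = "{p :: 'g \<times> 'g. cmod (f (fst p + snd p) - f (snd p)) < e}"
    have "continuous_on UNIV (\<lambda>p :: 'g \<times> 'g. f (fst p + snd p))"
      by (rule continuous_on_compose2[OF cont]) (auto intro!: continuous_intros)
    moreover have "continuous_on UNIV (\<lambda>p :: 'g \<times> 'g. f (snd p))"
      by (rule continuous_on_compose2[OF cont]) (auto intro!: continuous_intros)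
    ultimately have "open ?W"
      by (intro open_Collect_less continuous_on_norm continuous_on_diff continuous_on_const)
    moreover have "{0} \<times> UNIV \<subseteq> ?W"
      using that by auto
    ultimately obtain V where V: "0 \<in> V" "open V" "V \<times> UNIV \<subseteq> ?W"
      using Elementary_Topology.tube_lemma[OF assms, of ?W 0] by blast
    have "cmod (f s - f t) < e" if "s - t \<in> V" for s t
    proof -
      have "(s - t, t) \<in> ?W"
        using V(3) that by blast
      then show ?thesis
        by simp
    qed
    with V show ?thesis
      by blast
  qed
  with bdd show "f \<in> LUC"
    by (simp add: LUC_def)
qed

lemma bcontfun_subset_LUC_if_discrete:
  assumes "open {0 :: 'g::topological_group_add}"
  shows "(bcontfun :: ('g \<Rightarrow> complex) set) \<subseteq> LUC"
  using assms by (auto simp: bcontfun_def LUC_def intro!: exI[of _ "{0}"])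

lemma not_contains_linfty_copy_if_bcontfun_subset_LUC:
  assumes "(bcontfun :: ('g::topological_group_add \<Rightarrow> complex) set) \<subseteq> LUC" and "I \<noteq> {}"
  shows "\<not> contains_linfty_copy (smul :: complex \<Rightarrow> 'g cb_mod_luc \<Rightarrow> _) I"
proof
  assume "contains_linfty_copy smul I"
  then obtain T :: "_ \<Rightarrow> 'g cb_mod_luc" where T: "\<And>x. x \<in> linfty I \<Longrightarrow> norm (T x) = linfty_norm x"
    unfolding contains_linfty_copy_def by blast
  have trivial: "v = 0" for v :: "'g cb_mod_luc"
  proof transfer
    fix f :: "'g \<Rightarrow>\<^sub>C complex"
    show "luc_rel f 0"
      using assms(1) apply_bcontfun[of f] by (auto simp: luc_rel_def LUC_bcontfun_def)
  qed
  from assms(2) obtain i where i: "i \<in> I"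
    by blast
  let ?x = "\<lambda>j. if j = i then 1 else 0 :: complex"
  have bdd: "bounded (range ?x)"
    by (rule boundedI[of _ 1]) auto
  then have x: "?x \<in> linfty I"
    using i by (auto simp: linfty_def)
  have "1 = cmod (?x i)"
    by simp
  also have "\<dots> \<le> linfty_norm ?x"
    unfolding linfty_norm_def by (rule cSUP_upper) (auto intro!: bdd_aboveI[of _ 1])
  also have "\<dots> = norm (T ?x)"
    using T[OF x] by (rule sym)
  also have "T ?x = 0"
    by (rule trivial)
  finally show False
    by simp
qed

lemma Field_compact_covering_number_nonempty:
  "Field (compact_covering_number (UNIV :: 'a::topological_space set)) \<noteq> {}"
proof -
  obtain C :: "'a set set" where C: "compact_cover UNIV C" "compact_covering_number UNIV = card_of C"
    using compact_covering_number(1)[of "UNIV :: 'a set"] by (elim exE conjE)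
  have "C \<noteq> {}"
    using C(1) by (auto simp: compact_cover_def)
  then show ?thesis
    by (simp only: C(2) Field_card_of not_False_eq_True)
qed

lemma discrete_topology_iff_open_zero:
  "(euclidean :: 'g::topological_group_add topology) = discrete_topology UNIV \<longleftrightarrow> open {0 :: 'g}"
proof
  assume "(euclidean :: 'g topology) = discrete_topology UNIV"
  then have "openin (euclidean :: 'g topology) {0}"
    by simp
  then show "open {0 :: 'g}"
    by simp
next
  assume zero: "open {0 :: 'g}"
  have "open {x}" for x :: 'g
  proof -
    have "open ((\<lambda>s. s - x) -` {0})"
      by (intro open_vimage zero continuous_intros)
    also have "(\<lambda>s. s - x) -` {0} = {x}"
      by auto
    finally show ?thesis .
  qed
  then have "openin (euclidean :: 'g topology) {x}" for x
    by simp
  then show "(euclidean :: 'g topology) = discrete_topology UNIV"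
    by (metis discrete_topology_unique topspace_euclidean)
qed


section \<open>Oscillation at arbitrarily small scales\<close>

lemma urysohn_locally_compact_group:
  fixes S :: "'g::{topological_group_add, t2_space} set"
  assumes "locally_compact_space (euclidean :: 'g topology)" "closed S" "x \<notin> S"
  obtains f :: "'g \<Rightarrow> real" where "continuous_on UNIV f" "range f \<subseteq> {0..1}" "f x = 1" "f ` S \<subseteq> {0}"
proof -
  have "Hausdorff_space (euclidean :: 'g topology)"
    unfolding Hausdorff_space_def disjnt_def using hausdorff[where 'a='g] by (simp only: open_openin[symmetric]) blast
  then have "completely_regular_space (euclidean :: 'g topology)"
    using assms(1) locally_compact_regular_imp_completely_regular_space by blast
  moreover have "closedin (euclidean :: 'g topology) S" "x \<in> topspace euclidean - S"
    using assms by auto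
  ultimately obtain g :: "'g \<Rightarrow> real"
    where g: "continuous_map euclidean (top_of_set {0..1}) g" "g x = 0" "g ` S \<subseteq> {1}"
    unfolding completely_regular_space_def by metis
  have "continuous_on UNIV g" "range g \<subseteq> {0..1}"
    using g(1) by (auto simp: continuous_map_in_subtopology)
  then show thesis
    using g(2,3) by (intro that[of "\<lambda>y. 1 - g y"]) (auto intro!: continuous_intros)
qed

text \<open>
  Near an accumulation point of the sequence, differences are small in both orders, so the
  later term can always be taken first.
\<close>

lemma small_differences_in_compact:
  fixes x :: "nat \<Rightarrow> 'g::{topological_group_add, t2_space}"
  assumes "compact K" "range x \<subseteq> K" "inj x" "open V" "0 \<in> V"
  shows "\<exists>m n. m < n \<and> x n - x m \<in> V"
proof -
  have "infinite (range x)"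
    using assms(3) by (simp add: finite_image_iff)
  then obtain p where p: "p islimpt range x"
    using Heine_Borel_imp_Bolzano_Weierstrass assms(1,2) by blast
  have "open ((\<lambda>q::'g \<times> 'g. fst q - snd q) -` V)"
    by (intro open_vimage assms continuous_intros)
  moreover have "(p, p) \<in> (\<lambda>q. fst q - snd q) -` V"
    using assms(5) by simp
  ultimately obtain A B where AB: "open A" "open B" "p \<in> A" "p \<in> B"
    "A \<times> B \<subseteq> (\<lambda>q. fst q - snd q) -` V"
    by (rule open_prod_elim) auto
  have "infinite ((A \<inter> B) \<inter> range x)"
    using p AB by (auto simp: islimpt_eq_acc_point)
  then have "infinite (x -` (A \<inter> B))"
    using finite_imageI[of "x -` (A \<inter> B)" x] unfolding image_vimage_eq by blast
  then obtain m where m: "x m \<in> A \<inter> B"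
    using infinite_imp_nonempty by blast
  obtain n where n: "x n \<in> A \<inter> B" "m < n"
    using \<open>infinite (x -` (A \<inter> B))\<close> by (metis infinite_nat_iff_unbounded vimageE)
  have "(x n, x m) \<in> (\<lambda>q. fst q - snd q) -` V"
    using m n AB(5) by blast
  with n show ?thesis
    by auto
qed

text \<open>
  Functions supported in \<open>U\<close> that oscillate fully between \<open>-1\<close> and \<open>1\<close>, jointly at all scales.
  Compactness of \<open>K\<close> forces the differences of the chosen points to be small; failure of
  discreteness provides infinitely many points to choose from.
\<close>

lemma oscillating_sequence:
  fixes U :: "'g::{topological_group_add, t2_space} set"
  assumes lc: "locally_compact_space (euclidean :: 'g topology)"
    and nondiscrete: "\<not> open {0 :: 'g}"
    and U: "open U" "0 \<in> U" "U \<subseteq> K" "compact K"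
  obtains \<psi> :: "nat \<Rightarrow> 'g \<Rightarrow> real" and x :: "nat \<Rightarrow> 'g"
  where "\<And>n. continuous_on UNIV (\<psi> n)" "\<And>n y. \<bar>\<psi> n y\<bar> \<le> 1" "\<And>n y. y \<notin> U \<Longrightarrow> \<psi> n y = 0"
    "\<And>n. x n \<in> U" "\<And>n. \<psi> n (x n) = 1" "\<And>m n. m < n \<Longrightarrow> \<psi> n (x m) = -1"
    "\<And>V. open V \<Longrightarrow> 0 \<in> V \<Longrightarrow> \<exists>m n. m < n \<and> x n - x m \<in> V"
proof -
  obtain \<theta> :: "'g \<Rightarrow> real"
    where \<theta>: "continuous_on UNIV \<theta>" "range \<theta> \<subseteq> {0..1}" "\<theta> 0 = 1" "\<theta> ` (- U) \<subseteq> {0}"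
    using urysohn_locally_compact_group[OF lc, of "- U" 0] U(1,2) by auto
  \<comment> \<open>On \<open>W\<close> the cut-off function \<open>min 1 (2 \<theta>)\<close> is constantly \<open>1\<close>. Subtracting it from
    twice a function \<open>0 \<le> b \<le> 1\<close> supported in \<open>W\<close> gives the value \<open>-1\<close> at the zeros
    of \<open>b\<close> in \<open>W\<close> and keeps all values in \<open>[-1, 1]\<close>.\<close>
  define W where "W = {y. 1 / 2 < \<theta> y}"
  have W: "open W" "0 \<in> W" "W \<subseteq> U"
  proof -
    show "open W"
      unfolding W_def by (intro open_Collect_less \<theta>(1) continuous_intros)
    show "0 \<in> W"
      using \<theta>(3) by (simp add: W_def)
    show "W \<subseteq> U"
    proof
      fix y assume "y \<in> W"
      show "y \<in> U"
      proof (rule ccontr)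
        assume "y \<notin> U"
        then have "\<theta> y = 0"
          using \<theta>(4) by blast
        with \<open>y \<in> W\<close> show False
          by (simp add: W_def)
      qed
    qed
  qed
  have "infinite W"
  proof
    assume "finite W"
    then have "open (W - (W - {0}))"
      using W(1) by (intro open_Diff finite_imp_closed) auto
    also have "W - (W - {0}) = {0}"
      using W(2) by blast
    finally show False
      using nondiscrete by simp
  qed
  then obtain x :: "nat \<Rightarrow> 'g" where x: "inj x" "range x \<subseteq> W"
    using infinite_countable_subset by blast
  have "\<exists>b :: 'g \<Rightarrow> real. continuous_on UNIV b \<and> range b \<subseteq> {0..1} \<and> b (x n) = 1 \<and>
      b ` (- W \<union> x ` {..<n}) \<subseteq> {0}" for n
  proof -
    have "closed (- W \<union> x ` {..<n})"
      using W(1) by (simp add: closed_Un closed_def[of "- W"] finite_imp_closed)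
    moreover have "x n \<notin> - W \<union> x ` {..<n}"
      using x by (auto dest: injD)
    ultimately show ?thesis
      using urysohn_locally_compact_group[OF lc] by metis
  qed
  then obtain b :: "nat \<Rightarrow> 'g \<Rightarrow> real" where b: "\<And>n. continuous_on UNIV (b n)" "\<And>n. range (b n) \<subseteq> {0..1}"
    "\<And>n. b n (x n) = 1" "\<And>n. b n ` (- W \<union> x ` {..<n}) \<subseteq> {0}"
    by metis
  have b0: "b n y = 0" if "y \<notin> W" for n y
    using b(4)[of n] that by blast
  have b01: "0 \<le> b n y" "b n y \<le> 1" for n y
    using b(2)[of n] by (auto simp: image_subset_iff)
  have \<theta>01: "0 \<le> \<theta> y" "\<theta> y \<le> 1" for y
    using \<theta>(2) by (auto simp: image_subset_iff)
  have \<theta>W: "min 1 (2 * \<theta> y) = 1" if "y \<in> W" for y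
    using that by (simp add: W_def)
  let ?\<psi> = "\<lambda>n y. 2 * b n y - min 1 (2 * \<theta> y)"
  show thesis
  proof (rule that[of ?\<psi> x])
    show "continuous_on UNIV (?\<psi> n)" for n
      by (intro continuous_intros b(1) \<theta>(1))
    show "\<bar>?\<psi> n y\<bar> \<le> 1" for n y
    proof (cases "y \<in> W")
      case True
      show ?thesis
        using b01[of n y] unfolding \<theta>W[OF True] by linarith
    next
      case False
      then show ?thesis
        using \<theta>01[of y] by (simp add: b0)
    qed
    show "?\<psi> n y = 0" if "y \<notin> U" for n y
    proof -
      have "\<theta> y = 0" "y \<notin> W"
        using \<theta>(4) W(3) that by auto
      then show ?thesis
        by (simp add: b0)
    qed
    show "x n \<in> U" for n
      using x W by blast
    show "?\<psi> n (x n) = 1" for n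
    proof -
      have "x n \<in> W"
        using x by blast
      from \<theta>W[OF this] show ?thesis
        by (simp add: b(3))
    qed
    show "?\<psi> n (x m) = -1" if "m < n" for m n
    proof -
      have "x m \<in> W"
        using x by blast
      moreover have "b n (x m) = 0"
        using b(4)[of n] that by blast
      ultimately show ?thesis
        using \<theta>W[of "x m"] by simp
    qed
    show "\<exists>m n. m < n \<and> x n - x m \<in> V" if "open V" "0 \<in> V" for V
      using that x W(3) U by (intro small_differences_in_compact[of K]) auto
  qed
qed

text \<open>
  A uniformly continuous \<open>h\<close> takes nearly the same value at \<open>s\<close> and \<open>t\<close>, and no complex number
  is closer than \<open>\<bar>c\<bar>\<close> to both \<open>c\<close> and \<open>- c\<close>.
\<close>

lemma norm_le_if_opposite_values_close:
  fixes f h :: "'g::topological_group_add \<Rightarrow> complex"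
  assumes "h \<in> LUC"
    and opposite: "\<And>V. open V \<Longrightarrow> 0 \<in> V \<Longrightarrow> \<exists>s t. s - t \<in> V \<and> f s = c \<and> f t = - c"
    and bound: "\<And>s. cmod (f s - h s) \<le> r"
  shows "cmod c \<le> r"
proof (rule field_le_epsilon)
  fix e :: real
  assume "e > 0"
  then obtain V where V: "open V" "0 \<in> V" "\<And>s t. s - t \<in> V \<Longrightarrow> cmod (h s - h t) < e"
    using assms(1) unfolding LUC_def by blast
  obtain s t where st: "s - t \<in> V" "f s = c" "f t = - c"
    using opposite[OF V(1,2)] by blast
  have "2 * c = (f s - h s) + (h s - h t) - (f t - h t)"
    using st by simp
  then have "cmod (2 * c) \<le> cmod (f s - h s) + cmod (h s - h t) + cmod (f t - h t)"
    by (metis norm_triangle_ineq norm_triangle_ineq4 order_trans add_right_mono)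
  also have "\<dots> \<le> r + e + r"
    using bound[of s] bound[of t] V(3)[OF st(1)] by linarith
  finally have "2 * cmod c \<le> 2 * r + e"
    by (simp add: norm_mult)
  with \<open>e > 0\<close> show "cmod c \<le> r + e"
    by linarith
qed


section \<open>Separated families of translates\<close>

text \<open>
  The differences \<open>p - q\<close> of points for which the translates \<open>U + p\<close> and \<open>U + q\<close> both meet
  one and the same translate of \<open>U\<close>. If these are excluded for distinct points of a family,
  the translates of \<open>U\<close> by the family are disjoint and locally finite.
\<close>

definition fourfold_difference :: "'g::group_add set \<Rightarrow> 'g set"
  where "fourfold_difference U = {- a + b - c + d |a b c d. a \<in> U \<and> b \<in> U \<and> c \<in> U \<and> d \<in> U}"

lemma fourfold_difference_mono: "U \<subseteq> K \<Longrightarrow> fourfold_difference U \<subseteq> fourfold_difference K"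
  unfolding fourfold_difference_def by blast

lemma compact_fourfold_difference:
  fixes K :: "'g::topological_group_add set"
  assumes "compact K"
  shows "compact (fourfold_difference K)"
proof -
  have "fourfold_difference K =
      (\<lambda>p. - fst p + fst (snd p) - fst (snd (snd p)) + snd (snd (snd p))) ` (K \<times> K \<times> K \<times> K)"
    (is "_ = ?f ` _")
  proof (intro equalityI subsetI)
    fix l
    assume "l \<in> fourfold_difference K"
    then obtain a b c d where "l = - a + b - c + d" "a \<in> K" "b \<in> K" "c \<in> K" "d \<in> K"
      unfolding fourfold_difference_def by blast
    then show "l \<in> ?f ` (K \<times> K \<times> K \<times> K)"
      by (intro image_eqI[of _ _ "(a, b, c, d)"]) auto
  next
    fix l
    assume "l \<in> ?f ` (K \<times> K \<times> K \<times> K)"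
    then obtain a b c d where "l = - a + b - c + d" "a \<in> K" "b \<in> K" "c \<in> K" "d \<in> K"
      by auto
    then show "l \<in> fourfold_difference K"
      unfolding fourfold_difference_def by blast
  qed
  then show ?thesis
    by (simp only:) (intro compact_continuous_image compact_Times assms continuous_intros)
qed

lemma uminus_fourfold_difference:
  assumes "l \<in> fourfold_difference U"
  shows "- l \<in> fourfold_difference U"
proof -
  obtain a b c d where l: "l = - a + b - c + d" and mem: "a \<in> U" "b \<in> U" "c \<in> U" "d \<in> U"
    using assms unfolding fourfold_difference_def by blast
  have "- l = - d + c - b + a"
    unfolding l by (simp add: minus_add diff_conv_add_uminus add.assoc del: add_uminus_conv_diff)
  with mem show ?thesis
    unfolding fourfold_difference_def by blast
qed

lemma zero_in_fourfold_difference: "u \<in> U \<Longrightarrow> 0 \<in> fourfold_difference U"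
  unfolding fourfold_difference_def by (intro CollectI exI[of _ u]) simp

lemma maximal_separated_set:
  fixes L :: "'g::group_add set"
  assumes "0 \<in> L" and sym: "\<And>l. l \<in> L \<Longrightarrow> - l \<in> L"
  obtains T where "pairwise (\<lambda>s t. s - t \<notin> L) T" "\<And>g. \<exists>t\<in>T. g - t \<in> L"
proof -
  define A where "A = {T. pairwise (\<lambda>s t. s - t \<notin> L) T}"
  have "\<exists>M\<in>A. \<forall>X\<in>A. M \<subseteq> X \<longrightarrow> X = M"
  proof (rule subset_Zorn')
    fix C
    assume C: "subset.chain A C"
    have "s - t \<notin> L" if "s \<in> X" "X \<in> C" "t \<in> Y" "Y \<in> C" "s \<noteq> t" for s t X Y
    proof -
      have "X \<subseteq> Y \<or> Y \<subseteq> X" "X \<in> A" "Y \<in> A"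
        using C that by (auto simp: subset_chain_def)
      then show ?thesis
        using that unfolding A_def pairwise_def by blast
    qed
    then show "\<Union>C \<in> A"
      unfolding A_def pairwise_def by blast
  qed
  then obtain M where M: "M \<in> A" "\<And>X. X \<in> A \<Longrightarrow> M \<subseteq> X \<Longrightarrow> X = M"
    by blast
  have "\<exists>t\<in>M. g - t \<in> L" for g
  proof (rule ccontr)
    assume g: "\<not> (\<exists>t\<in>M. g - t \<in> L)"
    have "t - g \<notin> L" if "t \<in> M" for t
      using g that sym[of "t - g"] by auto
    with g M(1) have "insert g M \<in> A"
      by (auto simp: A_def pairwise_def)
    with M(2) have "g \<in> M"
      by blast
    with g assms(1) show False
      by auto
  qed
  with M(1) show thesis
    by (intro that[of M]) (auto simp: A_def pairwise_def)
qed

text \<open>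
  Infinitely many copies of \<open>\<kappa>(G)\<close> fit into a maximal separated set \<open>T\<close>: it is infinite
  because finitely many translates of \<open>L\<close> cannot cover a noncompact group, and
  \<open>\<kappa>(G) \<le> \<bar>T\<bar>\<close> then gives \<open>\<kappa>(G) \<cdot> \<aleph>\<^sub>0 \<le> \<bar>T\<bar>\<close>.
\<close>

lemma separated_family:
  fixes L :: "'g::topological_group_add set"
  assumes "\<not> compact (UNIV :: 'g set)" "compact L" "0 \<in> L" "\<And>l. l \<in> L \<Longrightarrow> - l \<in> L"
  defines "J \<equiv> Field (compact_covering_number (UNIV :: 'g set)) \<times> (UNIV :: nat set)"
  shows "\<exists>t. pairwise (\<lambda>i j. t i - t j \<notin> L) J"
proof -
  obtain T where sep: "pairwise (\<lambda>s t. s - t \<notin> L) T"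
    and cov: "\<And>g. \<exists>t\<in>T. g - t \<in> L"
    using maximal_separated_set[of L] assms by metis
  define C where "C = (\<lambda>t. (\<lambda>l. l + t) ` L) ` T"
  have compact: "\<forall>K\<in>C. compact K"
    unfolding C_def by (auto intro!: compact_continuous_image assms continuous_intros)
  have "g \<in> \<Union>C" for g
  proof -
    obtain t where t: "t \<in> T" "g - t \<in> L"
      using cov by blast
    have "g = (g - t) + t"
      by simp
    with t show ?thesis
      unfolding C_def by blast
  qed
  then have union: "\<Union>C = UNIV"
    by blast
  have inf: "infinite T"
  proof
    assume "finite T"
    then have "compact (\<Union>C)"
      using compact by (intro compact_Union) (auto simp: C_def)
    with assms(1) show False
      by (simp add: union)
  qed
  obtain D :: "'g set set" where D: "compact_covering_number (UNIV :: 'g set) = card_of D"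
    using compact_covering_number(1) by blast
  have "card_of D \<le>o card_of C"
    using compact_covering_number(2)[of UNIV C] compact union unfolding D compact_cover_def by blast
  also have "card_of C \<le>o card_of T"
    unfolding C_def by (rule card_of_image)
  finally have D_T: "card_of D \<le>o card_of T" .
  have "card_of (D \<times> (UNIV :: nat set)) \<le>o card_of T"
    using inf D_T infinite_iff_card_of_nat[of T]
    by (intro card_of_Times_ordLeq_infinite_Field) (simp_all add: Field_card_of card_of_Card_order card_of_card_order_on)
  then have "card_of J \<le>o card_of T"
    by (simp add: J_def D Field_card_of)
  then obtain t where t: "inj_on t J" "t ` J \<subseteq> T"
    using card_of_ordLeq by metis
  show ?thesis
  proof (intro exI[of _ t] pairwiseI)
    fix i j
    assume ij: "i \<in> J" "j \<in> J" "i \<noteq> j"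
    then have "t i \<in> T" "t j \<in> T" "t i \<noteq> t j"
      using t by (auto simp only: inj_on_eq_iff)
    then show "t i - t j \<notin> L"
      by (rule pairwiseD[OF sep])
  qed
qed

text \<open>
  For separated translates the sum has at most one term. Writing the function that equals
  \<open>\<phi> j\<close>, moved to \<open>t j\<close>, on each \<open>U + t j\<close> as a sum makes its linearity in \<open>\<phi>\<close> immediate.
\<close>

definition transplant :: "('j \<Rightarrow> 'g::group_add) \<Rightarrow> 'j set \<Rightarrow> 'g set \<Rightarrow> ('j \<Rightarrow> 'g \<Rightarrow> complex) \<Rightarrow> 'g \<Rightarrow> complex"
  where "transplant t J U \<phi> s = (\<Sum>j | j \<in> J \<and> s - t j \<in> U. \<phi> j (s - t j))"

context
  fixes t :: "'j \<Rightarrow> 'g::{topological_group_add, t2_space}" and J :: "'j set" and U :: "'g set"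
  assumes U: "open U" "0 \<in> U"
    and sep: "pairwise (\<lambda>i j. t i - t j \<notin> fourfold_difference U) J"
begin

text \<open>
  With \<open>s = s' = s0\<close> this is the disjointness of the translates of \<open>U\<close>; in general it is their local
  finiteness, as the neighbourhood \<open>U + s0\<close> of \<open>s0\<close> meets at most one of them.
\<close>

lemma translate_index_unique:
  assumes "i \<in> J" "j \<in> J" "s - t i \<in> U" "s' - t j \<in> U" "s - s0 \<in> U" "s' - s0 \<in> U"
  shows "i = j"
proof (rule ccontr)
  assume "i \<noteq> j"
  have "t i - t j = - (s - t i) + (s - s0) - (s' - s0) + (s' - t j)"
    by (simp add: minus_add diff_conv_add_uminus add.assoc del: add_uminus_conv_diff)
  also have "\<dots> \<in> fourfold_difference U"
    unfolding fourfold_difference_def using assms by blast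
  finally show False
    using pairwiseD[OF sep assms(1,2) \<open>i \<noteq> j\<close>] by simp
qed

lemma transplant_eq:
  assumes "j \<in> J" "s - t j \<in> U"
  shows "transplant t J U \<phi> s = \<phi> j (s - t j)"
proof -
  have "i = j" if "i \<in> J" "s - t i \<in> U" for i
    by (rule translate_index_unique[of i j s s s]) (use that assms U(2) in simp_all)
  with assms have "{j \<in> J. s - t j \<in> U} = {j}"
    by blast
  then show ?thesis
    by (simp add: transplant_def)
qed

lemma transplant_eq_0:
  assumes "\<And>j. j \<in> J \<Longrightarrow> s - t j \<notin> U"
  shows "transplant t J U \<phi> s = 0"
  unfolding transplant_def by (rule sum.neutral) (use assms in auto)

lemma continuous_on_transplant:
  assumes cont: "\<And>j. continuous_on UNIV (\<phi> j)"
    and zero: "\<And>j y. y \<notin> U \<Longrightarrow> \<phi> j y = 0"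
  shows "continuous_on UNIV (transplant t J U \<phi>)"
proof -
  have "isCont (transplant t J U \<phi>) s0" for s0
  proof -
    define N where "N = (\<lambda>s. s - s0) -` U"
    have N: "open N" "s0 \<in> N"
      unfolding N_def using U by (auto intro!: open_vimage continuous_intros)
    have "continuous_on N (transplant t J U \<phi>)"
    proof (cases "\<exists>s\<in>N. \<exists>j\<in>J. s - t j \<in> U")
      case True
      then obtain s j where sj: "s \<in> N" "j \<in> J" "s - t j \<in> U"
        by blast
      have "transplant t J U \<phi> s' = \<phi> j (s' - t j)" if "s' \<in> N" for s'
      proof (cases "s' - t j \<in> U")
        case True
        with sj show ?thesis
          by (intro transplant_eq)
      next
        case False
        have "s' - t i \<notin> U" if "i \<in> J" for i
          using translate_index_unique[of j i s s' s0] sj that \<open>s' \<in> N\<close> False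
          by (auto simp: N_def)
        then show ?thesis
          using zero[OF False] by (simp add: transplant_eq_0)
      qed
      moreover have "continuous_on N (\<lambda>s'. \<phi> j (s' - t j))"
        by (rule continuous_on_compose2[OF cont]) (auto intro!: continuous_intros)
      ultimately show ?thesis
        by (simp cong: continuous_on_cong)
    next
      case False
      then have "transplant t J U \<phi> s = 0" if "s \<in> N" for s
        using that by (intro transplant_eq_0) blast
      then show ?thesis
        by (simp cong: continuous_on_cong)
    qed
    with N show ?thesis
      by (simp add: continuous_on_eq_continuous_at)
  qed
  then show ?thesis
    by (simp add: continuous_at_imp_continuous_on)
qed

lemma norm_transplant_le:
  assumes "\<And>j y. j \<in> J \<Longrightarrow> cmod (\<phi> j y) \<le> r" "0 \<le> r"
  shows "cmod (transplant t J U \<phi> s) \<le> r"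
proof (cases "\<exists>j\<in>J. s - t j \<in> U")
  case True
  then show ?thesis
    using assms(1) by (auto simp: transplant_eq)
next
  case False
  then show ?thesis
    using assms(2) by (simp add: transplant_eq_0)
qed

end


section \<open>The isometric copy\<close>

lemma cmod_le_linfty_norm:
  assumes "x \<in> linfty I"
  shows "cmod (x i) \<le> linfty_norm x"
proof -
  have "bdd_above (range (\<lambda>i. cmod (x i)))"
    using assms by (auto simp: linfty_def bounded_iff intro: bdd_aboveI)
  then show ?thesis
    unfolding linfty_norm_def by (intro cSUP_upper) auto
qed

text \<open>
  The copy consists of the functions that are \<open>c i \<cdot> \<psi> n\<close>, moved by \<open>t (i, n)\<close>, near
  \<open>t (i, n)\<close>. For fixed \<open>i\<close>, all \<open>n\<close> together produce the values \<open>\<plusminus> c i\<close> at arbitrarily close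
  points, and right translation by \<open>t (i, n)\<close> does not change the differences of these points.
\<close>

lemma contains_linfty_copy_if_noncompact_nondiscrete:
  assumes lc: "locally_compact_space (euclidean :: 'g::{topological_group_add, t2_space} topology)"
    and noncompact: "\<not> compact (UNIV :: 'g set)"
    and nondiscrete: "\<not> open {0 :: 'g}"
  shows "contains_linfty_copy
           (scaleC_cb_mod_luc :: complex \<Rightarrow> 'g cb_mod_luc \<Rightarrow> 'g cb_mod_luc)
           (Field (compact_covering_number (UNIV :: 'g set)))"
proof -
  define I where "I = Field (compact_covering_number (UNIV :: 'g set))"
  obtain U K :: "'g set" where U: "open U" "0 \<in> U" "U \<subseteq> K" "compact K"
    using lc[unfolded locally_compact_space_def, rule_format, of 0] by auto
  obtain \<psi> :: "nat \<Rightarrow> 'g \<Rightarrow> real" and x where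
    \<psi>: "\<And>n. continuous_on UNIV (\<psi> n)" "\<And>n y. \<bar>\<psi> n y\<bar> \<le> 1" "\<And>n y. y \<notin> U \<Longrightarrow> \<psi> n y = 0"
    and x: "\<And>n. x n \<in> U" "\<And>n. \<psi> n (x n) = 1" "\<And>m n. m < n \<Longrightarrow> \<psi> n (x m) = -1"
      "\<And>V. open V \<Longrightarrow> 0 \<in> V \<Longrightarrow> \<exists>m n. m < n \<and> x n - x m \<in> V"
    using oscillating_sequence[OF lc nondiscrete U] by metis
  have "0 \<in> K"
    using U by blast
  then have "\<exists>t. pairwise (\<lambda>i j. t i - t j \<notin> fourfold_difference K) (I \<times> (UNIV :: nat set))"
    unfolding I_def
    by (intro separated_family noncompact compact_fourfold_difference U(4)
        zero_in_fourfold_difference uminus_fourfold_difference)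
  then obtain t where "pairwise (\<lambda>i j. t i - t j \<notin> fourfold_difference K) (I \<times> (UNIV :: nat set))" ..
  then have sep: "pairwise (\<lambda>i j. t i - t j \<notin> fourfold_difference U) (I \<times> UNIV)"
    using fourfold_difference_mono[OF U(3)] unfolding pairwise_def by blast
  define F where "F c = transplant t (I \<times> UNIV) U (\<lambda>(i, n) y. c i * of_real (\<psi> n y))"
    for c :: "'g set \<Rightarrow> complex"
  have F_eq: "F c (y + t (i, n)) = c i * of_real (\<psi> n y)" if "i \<in> I" "y \<in> U" for c i n y
    using transplant_eq[OF U(1,2) sep, of "(i, n)" "y + t (i, n)"] that by (simp add: F_def)
  have F_norm: "cmod (F c s) \<le> linfty_norm c" if "c \<in> linfty I" for c s
    unfolding F_def
  proof (rule norm_transplant_le[OF U(1,2) sep])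
    show "0 \<le> linfty_norm c"
      using cmod_le_linfty_norm[OF that] norm_ge_zero order_trans by blast
    fix j :: "'g set \<times> nat" and y
    obtain i n where j: "j = (i, n)"
      by fastforce
    have "cmod (c i) * \<bar>\<psi> n y\<bar> \<le> linfty_norm c * 1"
      using cmod_le_linfty_norm[OF that] \<psi>(2) \<open>0 \<le> linfty_norm c\<close> by (intro mult_mono) auto
    then show "cmod ((case j of (i, n) \<Rightarrow> \<lambda>y. c i * complex_of_real (\<psi> n y)) y) \<le> linfty_norm c"
      by (simp add: j norm_mult)
  qed
  have F_cont: "continuous_on UNIV (F c)" for c
    unfolding F_def case_prod_unfold
    by (rule continuous_on_transplant[OF U(1,2) sep])
       (intro continuous_intros \<psi>(1), simp add: \<psi>(3))
  have F_bcontfun: "F c \<in> bcontfun" if "c \<in> linfty I" for c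
    unfolding bcontfun_def using F_cont F_norm[OF that] by (auto intro: boundedI)
  have F_add: "F (\<lambda>i. c i + d i) s = F c s + F d s" for c d s
    unfolding F_def transplant_def
    by (simp add: sum.distrib[symmetric] case_prod_unfold distrib_right)
  have F_scale: "F (\<lambda>i. a * c i) s = a * F c s" for a c s
    unfolding F_def transplant_def
    by (simp add: sum_distrib_left case_prod_unfold mult.assoc)
  have F_dist: "linfty_norm c = (INF h\<in>LUC_bcontfun. norm (Bcontfun (F c) - h))"
    if c: "c \<in> linfty I" for c
  proof (rule antisym)
    have apply_F: "apply_bcontfun (Bcontfun (F c)) = F c"
      using F_bcontfun[OF c] by (rule Bcontfun_inverse)
    show "linfty_norm c \<le> (INF h\<in>LUC_bcontfun. norm (Bcontfun (F c) - h))"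
    proof (rule cINF_greatest)
      show "LUC_bcontfun \<noteq> {}"
        using LUC_bcontfun_zero by blast
      fix h :: "'g \<Rightarrow>\<^sub>C complex"
      assume h: "h \<in> LUC_bcontfun"
      have bound: "cmod (F c s - h s) \<le> norm (Bcontfun (F c) - h)" for s
        using norm_bounded[of "Bcontfun (F c) - h" s] by (simp add: apply_F)
      show "linfty_norm c \<le> norm (Bcontfun (F c) - h)"
        unfolding linfty_norm_def
      proof (rule cSUP_least)
        fix i
        show "cmod (c i) \<le> norm (Bcontfun (F c) - h)"
        proof (cases "i \<in> I")
          case True
          show ?thesis
          proof (rule norm_le_if_opposite_values_close[of h "F c"])
            show "apply_bcontfun h \<in> LUC"
              using h by (simp add: LUC_bcontfun_def)
            fix V :: "'g set"
            assume "open V" "0 \<in> V"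
            then obtain m n where mn: "m < n" "x n - x m \<in> V"
              using x(4) by blast
            have "(x n + t (i, n)) - (x m + t (i, n)) = x n - x m"
              by (simp add: minus_add diff_conv_add_uminus add.assoc del: add_uminus_conv_diff)
            with mn True show "\<exists>s t. s - t \<in> V \<and> F c s = c i \<and> F c t = - c i"
              by (intro exI[of _ "x n + t (i, n)"] exI[of _ "x m + t (i, n)"])
                 (simp add: F_eq x)
          qed (rule bound)
        next
          case False
          with c show ?thesis
            by (simp add: linfty_def)
        qed
      qed simp
    qed
    have "(INF h\<in>LUC_bcontfun. norm (Bcontfun (F c) - h)) \<le> norm (Bcontfun (F c) - 0)"
      by (rule cINF_lower) (auto simp: LUC_bcontfun_zero intro!: bdd_belowI[of _ 0])
    also have "\<dots> \<le> linfty_norm c"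
      using F_norm[OF c] by (auto intro!: norm_bound simp: apply_F)
    finally show "(INF h\<in>LUC_bcontfun. norm (Bcontfun (F c) - h)) \<le> linfty_norm c" .
  qed
  have add_mem: "(\<lambda>i. c i + d i) \<in> linfty I" if "c \<in> linfty I" "d \<in> linfty I" for c d :: "'g set \<Rightarrow> complex"
    using that by (auto simp: linfty_def intro: bounded_plus_comp)
  have scale_mem: "(\<lambda>i. a * c i) \<in> linfty I" if "c \<in> linfty I" for a and c :: "'g set \<Rightarrow> complex"
    using that by (auto simp: linfty_def intro: bounded_range_mult)
  show ?thesis
    unfolding contains_linfty_copy_def I_def[symmetric]
  proof (intro exI[of _ "\<lambda>c. abs_cb_mod_luc (Bcontfun (F c))"] conjI ballI allI)
    fix c d :: "'g set \<Rightarrow> complex"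
    assume cd: "c \<in> linfty I" "d \<in> linfty I"
    have "Bcontfun (F (\<lambda>i. c i + d i)) = Bcontfun (F c) + Bcontfun (F d)"
      by (rule bcontfun_eqI)
         (simp add: Bcontfun_inverse F_bcontfun cd add_mem F_add)
    then show "abs_cb_mod_luc (Bcontfun (F (\<lambda>i. c i + d i))) =
        abs_cb_mod_luc (Bcontfun (F c)) + abs_cb_mod_luc (Bcontfun (F d))"
      by (simp add: plus_cb_mod_luc.abs_eq)
  next
    fix a and c :: "'g set \<Rightarrow> complex"
    assume c: "c \<in> linfty I"
    have "Bcontfun (F (\<lambda>i. a * c i)) = scaleC_bcontfun a (Bcontfun (F c))"
      by (rule bcontfun_eqI)
         (simp add: Bcontfun_inverse F_bcontfun c scale_mem F_scale scaleC_bcontfun.rep_eq)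
    then show "abs_cb_mod_luc (Bcontfun (F (\<lambda>i. a * c i))) =
        scaleC_cb_mod_luc a (abs_cb_mod_luc (Bcontfun (F c)))"
      by (simp add: scaleC_cb_mod_luc.abs_eq)
  next
    fix c :: "'g set \<Rightarrow> complex"
    assume "c \<in> linfty I"
    then show "norm (abs_cb_mod_luc (Bcontfun (F c))) = linfty_norm c"
      by (simp add: norm_cb_mod_luc.abs_eq F_dist)
  qed
qed

theorem theorem6p2:
  assumes "locally_compact_space (euclidean :: 'g::{topological_group_add, t2_space} topology)"
  shows "contains_linfty_copy
           (scaleC_cb_mod_luc :: complex \<Rightarrow> 'g cb_mod_luc \<Rightarrow> 'g cb_mod_luc)
           (Field (compact_covering_number (UNIV :: 'g set)))
         \<longleftrightarrow> \<not> compact (UNIV :: 'g set) \<and> (euclidean :: 'g topology) \<noteq> discrete_topology UNIV"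
proof (cases "compact (UNIV :: 'g set) \<or> open {0 :: 'g}")
  case True
  then have "(bcontfun :: ('g \<Rightarrow> complex) set) \<subseteq> LUC"
    by (elim disjE bcontfun_subset_LUC_if_compact bcontfun_subset_LUC_if_discrete)
  then have "\<not> contains_linfty_copy
      (scaleC_cb_mod_luc :: complex \<Rightarrow> 'g cb_mod_luc \<Rightarrow> 'g cb_mod_luc)
      (Field (compact_covering_number (UNIV :: 'g set)))"
    using Field_compact_covering_number_nonempty
    by (rule not_contains_linfty_copy_if_bcontfun_subset_LUC)
  with True show ?thesis
    unfolding discrete_topology_iff_open_zero by blast
next
  case False
  with contains_linfty_copy_if_noncompact_nondiscrete[OF assms] show ?thesis
    unfolding discrete_topology_iff_open_zero by blast
qed

end
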